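(* Let $T_1,T_2,T_3,T_4\in\mathcal{B}_A(\mathcal{H})$ and let $i$ denote the imaginary unit when it multiplies an operator. Then $$w_{\mathbb{A}}\left(\begin{bmatrix}T_1&T_2&T_3&T_4\\ T_2&T_3&T_4&iT_1\\ T_3&T_4&iT_1&iT_2\\ T_4&iT_1&iT_2&iT_3\end{bmatrix}\right)\le w_A(T_4)+2\max\{w_A(T_1),w_A(T_3)\}+\frac1{\sqrt2}\left(\|T_1-T_2\|_A+\|T_1+T_2\|_A\right)+\frac1{\sqrt2}\left(\|T_2-T_3\|_A+\|T_2+T_3\|_A\right).$$
   Context: $\mathcal{H}$ is a complex Hilbert space with inner product $\langle\cdot,\cdot\rangle$, $\mathcal{B}(\mathcal{H})$ is the algebra of bounded linear operators on $\mathcal{H}$, and $A\in\mathcal{B}(\mathcal{H})$ is a fixed positive operator ($\langle Ax,x\rangle\ge 0$ for all $x$). Put $\langle x,y\rangle_A=\langle Ax,y\rangle$ and $\|x\|_A=\sqrt{\langle x,x\rangle_A}$. $\mathcal{B}_A(\mathcal{H})$ is the set of $T\in\mathcal{B}(\mathcal{H})$ admitting an $A$-adjoint, i.e. for which there is $X\in\mathcal{B}(\mathcal{H})$ with $AX=T^*A$ (equivalently $\mathcal{R}(T^*A)\subseteq\mathcal{R}(A)$). The $A$-operator seminorm is $\|T\|_A=\sup_{x\in\overline{\mathcal{R}(A)},\,x\ne0}\|Tx\|_A/\|x\|_A$ and the $A$-numerical radius is $w_A(T)=\sup\{|\langle Tx,x\rangle_A|: x\in\mathcal{H},\ \|x\|_A=1\}$.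 $\mathbb{A}$ denotes the $4\times4$ block diagonal operator matrix on $\bigoplus_{i=1}^4\mathcal{H}$ with all diagonal entries $A$, and $w_{\mathbb{A}}$ is the numerical radius defined in the same way with $\mathcal{H},A$ replaced by $\bigoplus_{i=1}^4\mathcal{H},\mathbb{A}$. *)

theory Defs
  imports "HOL-Analysis.Analysis" "HOL-Library.Function_Algebras"
begin

section \<open>Complex Hilbert spaces\<close>

class scaleC =
  fixes scaleC :: "complex \<Rightarrow> 'a \<Rightarrow> 'a"  (infixr \<open>*\<^sub>C\<close> 75)

class complex_vector = real_vector + scaleC +
  assumes scaleC_add_right: "a *\<^sub>C (x + y) = a *\<^sub>C x + a *\<^sub>C y"
    and scaleC_add_left: "(a + b) *\<^sub>C x = a *\<^sub>C x + b *\<^sub>C x"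
    and scaleC_scaleC: "a *\<^sub>C (b *\<^sub>C x) = (a * b) *\<^sub>C x"
    and scaleC_one: "1 *\<^sub>C x = x"
    and scaleR_scaleC: "r *\<^sub>R x = complex_of_real r *\<^sub>C x"

text \<open>
  The inner product is linear in its first argument.  The real inner product inherited from
  \<open>real_inner\<close> is its real part, so positive definiteness and
  \<open>norm x = sqrt (Re (cinner x x))\<close> are already part of the superclass axioms.
\<close>

class complex_inner = complex_vector + real_inner +
  fixes cinner :: "'a \<Rightarrow> 'a \<Rightarrow> complex"
  assumes cinner_commute: "cinner x y = cnj (cinner y x)"
    and cinner_add_left: "cinner (x + y) z = cinner x z + cinner y z"
    and cinner_scaleC_left: "cinner (a *\<^sub>C x) y = a * cinner x y"
    and inner_eq_Re_cinner: "inner x y = Re (cinner x y)"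

class chilbert_space = complex_inner + complete_space

instantiation complex :: chilbert_space
begin
definition scaleC_complex :: "complex \<Rightarrow> complex \<Rightarrow> complex"
  where "scaleC_complex a x = a * x"
definition cinner_complex :: "complex \<Rightarrow> complex \<Rightarrow> complex"
  where "cinner_complex x y = x * cnj y"
instance
  by standard
    (simp_all add: scaleC_complex_def cinner_complex_def inner_complex_def algebra_simps
      scaleR_conv_of_real)
end

text \<open>The type \<open>'a ^ 'n\<close> carries the structure of the Hilbert direct sum of copies of \<open>'a\<close>.\<close>

instantiation vec :: (scaleC, finite) scaleC
begin
definition scaleC_vec :: "complex \<Rightarrow> 'a ^ 'b \<Rightarrow> 'a ^ 'b"
  where "scaleC_vec a x = (\<chi> i. a *\<^sub>C (x $ i))"
instance ..
end

instance vec :: (complex_vector, finite) complex_vector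
  by standard
    (simp_all add: scaleC_vec_def vec_eq_iff scaleC_add_right scaleC_add_left scaleC_scaleC
      scaleC_one scaleR_scaleC)

instantiation vec :: (complex_inner, finite) complex_inner
begin
definition cinner_vec :: "'a ^ 'b \<Rightarrow> 'a ^ 'b \<Rightarrow> complex"
  where "cinner_vec x y = (\<Sum>i\<in>UNIV. cinner (x $ i) (y $ i))"
instance
proof
  fix x y z :: "'a ^ 'b" and a :: complex
  show "cinner x y = cnj (cinner y x)"
    unfolding cinner_vec_def cnj_sum by (intro sum.cong refl cinner_commute)
  show "cinner (x + y) z = cinner x z + cinner y z"
    by (simp add: cinner_vec_def cinner_add_left sum.distrib)
  show "cinner (a *\<^sub>C x) y = a * cinner x y"
    by (simp add: cinner_vec_def scaleC_vec_def cinner_scaleC_left sum_distrib_left)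
  show "inner x y = Re (cinner x y)"
    by (simp add: cinner_vec_def inner_vec_def inner_eq_Re_cinner)
qed
end

instance vec :: (chilbert_space, finite) chilbert_space ..


section \<open>Operators\<close>

definition bounded_clinear :: "('a::complex_inner \<Rightarrow> 'b::complex_inner) \<Rightarrow> bool"
  where "bounded_clinear T \<longleftrightarrow> bounded_linear T \<and> (\<forall>c x. T (c *\<^sub>C x) = c *\<^sub>C T x)"

definition cadjoint :: "('a::complex_inner \<Rightarrow> 'b::complex_inner) \<Rightarrow> 'b \<Rightarrow> 'a"
  where "cadjoint T = (SOME S. \<forall>x y. cinner (T x) y = cinner x (S y))"

definition positive_op :: "('a::complex_inner \<Rightarrow> 'a) \<Rightarrow> bool"
  where "positive_op A \<longleftrightarrow> bounded_clinear A \<and> (\<forall>x. cinner (A x) x \<in> \<real>\<^sub>\<ge>\<^sub>0)"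

text \<open>
  Sums and differences of operators are the pointwise ones of \<open>Function_Algebras\<close>; scalar
  multiples are pointwise as well.
\<close>

instantiation "fun" :: (type, scaleC) scaleC
begin
definition scaleC_fun :: "complex \<Rightarrow> ('a \<Rightarrow> 'b) \<Rightarrow> 'a \<Rightarrow> 'b"
  where "scaleC_fun a T = (\<lambda>x. a *\<^sub>C T x)"
instance ..
end

text \<open>
  The operator given by an operator matrix, where \<open>M $ i $ j\<close> is the entry in row \<open>i\<close>,
  column \<open>j\<close>.  The library's \<open>mat T\<close> is then the block diagonal matrix with all
  diagonal entries \<open>T\<close>.
\<close>

definition block_op :: "('a::comm_monoid_add \<Rightarrow> 'a) ^ 'n ^ 'n \<Rightarrow> 'a ^ 'n \<Rightarrow> 'a ^ 'n"
  where "block_op M x = (\<chi> i. \<Sum>j\<in>UNIV. (M $ i $ j) (x $ j))"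


section \<open>The semi-inner product of a positive operator\<close>

definition A_inner :: "('a::complex_inner \<Rightarrow> 'a) \<Rightarrow> 'a \<Rightarrow> 'a \<Rightarrow> complex"
  where "A_inner A x y = cinner (A x) y"

definition A_seminorm :: "('a::complex_inner \<Rightarrow> 'a) \<Rightarrow> 'a \<Rightarrow> real"
  where "A_seminorm A x = sqrt (Re (A_inner A x x))"

definition A_adjointable :: "('a::complex_inner \<Rightarrow> 'a) \<Rightarrow> ('a \<Rightarrow> 'a) set"
  where "A_adjointable A =
    {T. bounded_clinear T \<and> (\<exists>X. bounded_clinear X \<and> A \<circ> X = cadjoint T \<circ> A)}"

text \<open>
  Suprema are taken in \<open>[0, \<infinity>]\<close>.  In particular the supremum of the empty set,
  which occurs when \<open>A = 0\<close>, is \<open>0\<close>.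
\<close>

definition A_opnorm :: "('a::complex_inner \<Rightarrow> 'a) \<Rightarrow> ('a \<Rightarrow> 'a) \<Rightarrow> ennreal"
  where "A_opnorm A T =
    (SUP x \<in> closure (range A) - {0}. ennreal (A_seminorm A (T x) / A_seminorm A x))"

definition A_numradius :: "('a::complex_inner \<Rightarrow> 'a) \<Rightarrow> ('a \<Rightarrow> 'a) \<Rightarrow> ennreal"
  where "A_numradius A T =
    (SUP x \<in> {x. A_seminorm A x = 1}. ennreal (cmod (A_inner A (T x) x)))"

end

theory Submission
  imports Defs
begin

text \<open>
  Collect the matrix by entries: it is the sum over \<open>k\<close> of \<open>T\<^sub>k \<otimes> U\<^sub>k\<close>, where each scalar
  matrix \<open>U\<^sub>k\<close> carries the coefficients \<open>0\<close>, \<open>1\<close>, \<open>\<i>\<close> of \<open>T\<^sub>k\<close>. Every \<open>U\<^sub>k\<close> is symmetric and has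
  exactly one nonzero entry in each row and column, so its quadratic form splits into diagonal
  terms \<open>\<langle>T x, x\<rangle>\<close> and symmetrized pairs \<open>\<langle>T x, y\<rangle> + \<langle>T y, x\<rangle>\<close>, each coordinate being used
  once. Polarization bounds such a pair by \<open>w(T) (\<parallel>x\<parallel>\<^sup>2 + \<parallel>y\<parallel>\<^sup>2)\<close> (\<open>symmetrized_form_le\<close>), so the
  part belonging to \<open>T\<^sub>k\<close> has numerical radius at most \<open>w(T\<^sub>k)\<close>. Hence the matrix has numerical
  radius at most \<open>w(T\<^sub>4) + w(T\<^sub>1) + w(T\<^sub>3) + w(T\<^sub>2)\<close> (\<open>A_numradius_hankel_le\<close>).

  It remains to see \<open>w(T\<^sub>1) + w(T\<^sub>3) \<le> 2 max {w(T\<^sub>1), w(T\<^sub>3)}\<close> and, writing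
  \<open>2 T\<^sub>2 = (T\<^sub>1 + T\<^sub>2) - (T\<^sub>1 - T\<^sub>2)\<close>,
  \<open>w(T\<^sub>2) \<le> 1/2 (\<parallel>T\<^sub>1 - T\<^sub>2\<parallel> + \<parallel>T\<^sub>1 + T\<^sub>2\<parallel>)\<close> (\<open>A_numradius_le_opnorm_diff_add\<close>),
  which the first bracket of the right-hand side dominates because \<open>1/2 \<le> 1/\<surd>2\<close>.

  The analytic content lies in comparing numerical radius and operator seminorm: the latter only
  tests vectors of the closure of the range of \<open>A\<close>. An arbitrary vector differs from its
  projection to that closure by a vector of the kernel of \<open>A\<close>, and an operator with an
  \<open>A\<close>-adjoint preserves this kernel. Projections and adjoints both come from one form of the
  Riesz representation theorem.
\<close>

section \<open>Riesz representation, adjoints and projections\<close>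

text \<open>
  The representing vector minimizes the functional \<open>\<parallel>y\<parallel>\<^sup>2 - 2 f y\<close> over \<open>V\<close>: the parallelogram law
  makes minimizing sequences Cauchy, and stationarity of the minimum is the claim. For
  \<open>V = UNIV\<close> this yields adjoints; for \<open>f = inner x\<close> the vector is the orthogonal projection of
  \<open>x\<close> to \<open>V\<close>.
\<close>

lemma riesz_closed_subspace:
  fixes V :: "'a::{real_inner,complete_space} set" and f :: "'a \<Rightarrow> real"
  assumes "subspace V" "closed V" "bounded_linear f"
  obtains v where "v \<in> V" "\<And>y. y \<in> V \<Longrightarrow> inner v y = f y"
proof -
  interpret f: bounded_linear f by fact
  define J where "J y = (norm y)\<^sup>2 - 2 * f y" for y
  define m where "m = Inf (J ` V)"
  obtain K where K: "\<And>y. norm (f y) \<le> norm y * K" using f.bounded by blast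
  have "- (K\<^sup>2) \<le> J y" for y
  proof -
    have "f y \<le> norm y * K" using K[of y] by simp
    moreover have "0 \<le> (norm y - K)\<^sup>2" by simp
    ultimately show ?thesis by (simp add: J_def power2_diff)
  qed
  then have bdd: "bdd_below (J ` V)" by (intro bdd_belowI2)
  have ne: "J ` V \<noteq> {}" using subspace_0[OF \<open>subspace V\<close>] by blast
  have m_le: "m \<le> J y" if "y \<in> V" for y
    unfolding m_def using that bdd by (intro cInf_lower) auto
  have "\<exists>y\<in>V. J y < m + 1 / Suc n" for n
  proof -
    have "Inf (J ` V) < m + 1 / Suc n" by (simp add: m_def)
    from cInf_lessD[OF ne this] show ?thesis by blast
  qed
  then obtain Y where YV: "\<And>n. Y n \<in> V" and Y: "\<And>n. J (Y n) < m + 1 / Suc n"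
    by metis
  have parallelogram: "(norm (y - z))\<^sup>2 \<le> 2 * J y + 2 * J z - 4 * m" if "y \<in> V" "z \<in> V" for y z
  proof -
    have "(1/2) *\<^sub>R (y + z) \<in> V"
      using that \<open>subspace V\<close> by (intro subspace_scale subspace_add)
    then have "m \<le> J ((1/2) *\<^sub>R (y + z))" by (rule m_le)
    moreover have "J y + J z = 2 * J ((1/2) *\<^sub>R (y + z)) + (norm (y - z))\<^sup>2 / 2"
      unfolding J_def power2_norm_eq_inner f.scaleR f.add
      by (simp add: inner_add_left inner_add_right inner_diff_left inner_diff_right
          inner_commute field_simps)
    ultimately show ?thesis by simp
  qed
  have "Cauchy Y"
  proof (rule metric_CauchyI)
    fix e :: real assume "0 < e"
    then obtain N where N: "inverse (real (Suc N)) < e\<^sup>2 / 4"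
      using reals_Archimedean[of "e\<^sup>2 / 4"] by auto
    have near: "J (Y k) < m + e\<^sup>2 / 4" if "k \<ge> N" for k
    proof -
      have "1 / Suc k \<le> 1 / Suc N" using that by (simp add: frac_le)
      with N Y[of k] show ?thesis by (simp add: inverse_eq_divide)
    qed
    have "dist (Y k) (Y l) < e" if "k \<ge> N" "l \<ge> N" for k l
    proof -
      have "(norm (Y k - Y l))\<^sup>2 < e\<^sup>2"
        using parallelogram[OF YV YV, of k l] near[OF that(1)] near[OF that(2)] by linarith
      then show ?thesis
        unfolding dist_norm by (rule power_less_imp_less_base) (rule less_imp_le[OF \<open>0 < e\<close>])
    qed
    then show "\<exists>N. \<forall>k\<ge>N. \<forall>l\<ge>N. dist (Y k) (Y l) < e" by blast
  qed
  then obtain v where v: "Y \<longlonglongrightarrow> v" using Cauchy_convergent_iff convergent_def by blast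
  have vV: "v \<in> V" using \<open>closed V\<close> YV v by (rule closed_sequentially)
  have "(\<lambda>n. J (Y n)) \<longlonglongrightarrow> J v"
    unfolding J_def by (intro tendsto_intros v f.tendsto)
  moreover have "(\<lambda>n. m + 1 / Suc n) \<longlonglongrightarrow> m + 0"
    using LIMSEQ_inverse_real_of_nat by (intro tendsto_intros) (simp add: inverse_eq_divide)
  ultimately have "J v \<le> m + 0"
    by (rule LIMSEQ_le) (use Y in \<open>blast intro: less_imp_le\<close>)
  then have min: "J v \<le> J y" if "y \<in> V" for y
    using m_le[OF that] by simp
  have "inner v y = f y" if "y \<in> V" for y
  proof (rule ccontr)
    define d where "d = inner v y - f y"
    assume "inner v y \<noteq> f y"
    then have "d \<noteq> 0" by (simp add: d_def)
    have *: "0 \<le> 2 * t * d + t\<^sup>2 * (norm y)\<^sup>2" for t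
    proof -
      have "v + t *\<^sub>R y \<in> V" using vV that \<open>subspace V\<close> by (intro subspace_add subspace_scale)
      from min[OF this] show ?thesis
        unfolding J_def d_def power2_norm_eq_inner f.scaleR f.add
        by (simp add: inner_add_left inner_add_right inner_commute algebra_simps power2_eq_square)
    qed
    \<comment> \<open>At \<open>t = - d / (1 + \<parallel>y\<parallel>\<^sup>2)\<close> the parabola of \<open>*\<close> is negative: this point lies strictly between
      \<open>0\<close> and the other root \<open>- 2 d / \<parallel>y\<parallel>\<^sup>2\<close>, and makes sense also for \<open>y = 0\<close>.\<close>
    have "(norm y)\<^sup>2 * d\<^sup>2 / (1 + (norm y)\<^sup>2)\<^sup>2 < 2 * d\<^sup>2 / (1 + (norm y)\<^sup>2)"
    proof -
      define q where "q = 1 + (norm y)\<^sup>2"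
      have "q > 0" by (simp add: q_def add_pos_nonneg)
      have "(norm y)\<^sup>2 * d\<^sup>2 < 2 * d\<^sup>2 * q"
        using \<open>d \<noteq> 0\<close> \<open>q > 0\<close> by (simp add: q_def algebra_simps add_pos_nonneg)
      then show ?thesis
        using \<open>q > 0\<close> unfolding q_def[symmetric]
        by (simp add: divide_simps power2_eq_square mult_ac)
    qed
    with *[of "- d / (1 + (norm y)\<^sup>2)"] show False
      by (simp add: power2_eq_square power_divide mult_ac)
  qed
  with vV show thesis by (rule that)
qed

lemma subspace_closure_set:
  fixes S :: "'a::real_normed_vector set"
  assumes "subspace S"
  shows "subspace (closure S)"
proof (rule subspaceI)
  show "0 \<in> closure S" using subspace_0[OF assms] closure_subset by blast
  show "x + y \<in> closure S" if xy: "x \<in> closure S" "y \<in> closure S" for x y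
  proof -
    from xy obtain X Y where "\<forall>n. X n \<in> S" "X \<longlonglongrightarrow> x" "\<forall>n. Y n \<in> S" "Y \<longlonglongrightarrow> y"
      unfolding closure_sequential by blast
    then have "\<forall>n. X n + Y n \<in> S" "(\<lambda>n. X n + Y n) \<longlonglongrightarrow> x + y"
      using assms by (simp_all add: subspace_add tendsto_add)
    then show ?thesis unfolding closure_sequential by (intro exI[of _ "\<lambda>n. X n + Y n"]) simp
  qed
  show "c *\<^sub>R x \<in> closure S" if x: "x \<in> closure S" for c x
  proof -
    from x obtain X where "\<forall>n. X n \<in> S" "X \<longlonglongrightarrow> x"
      unfolding closure_sequential by blast
    then have "\<forall>n. c *\<^sub>R X n \<in> S" "(\<lambda>n. c *\<^sub>R X n) \<longlonglongrightarrow> c *\<^sub>R x"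
      using assms by (simp_all add: subspace_scale tendsto_scaleR)
    then show ?thesis unfolding closure_sequential by (intro exI[of _ "\<lambda>n. c *\<^sub>R X n"]) simp
  qed
qed

lemma cinner_add_right: "cinner x (y + z) = cinner x y + cinner x z"
  by (metis cinner_add_left cinner_commute complex_cnj_add)

lemma cinner_scaleC_right: "cinner x (a *\<^sub>C y) = cnj a * cinner x y"
  by (metis cinner_scaleC_left cinner_commute complex_cnj_mult)

lemma cinner_zero_left [simp]: "cinner 0 y = 0"
  using cinner_add_left[of 0 0 y] by simp

lemma cinner_zero_right [simp]: "cinner x 0 = 0"
  using cinner_add_right[of x 0 0] by simp

text \<open>
  The constant \<open>cadjoint\<close> is a choice of an operator with this property, so the content is that one
  exists. The real Riesz theorem represents the real part of \<open>\<langle>T x, y\<rangle>\<close>; replacing \<open>x\<close> by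
  \<open>-\<i> x\<close> turns imaginary parts into real ones.
\<close>

lemma cinner_cadjoint:
  fixes T :: "'a::chilbert_space \<Rightarrow> 'b::complex_inner"
  assumes "bounded_clinear T"
  shows "cinner (T x) y = cinner x (cadjoint T y)"
proof -
  have bl: "bounded_linear T" and hom: "\<And>c x. T (c *\<^sub>C x) = c *\<^sub>C T x"
    using assms by (auto simp: bounded_clinear_def)
  have "\<exists>s. \<forall>x. cinner (T x) y = cinner x s" for y
  proof -
    have "bounded_linear (\<lambda>x. inner (T x) y)"
      using bounded_linear_compose[OF bounded_linear_inner_left bl] .
    from riesz_closed_subspace[OF subspace_UNIV closed_UNIV this]
    obtain s where "\<And>x. inner s x = inner (T x) y" by auto
    then have Re_eq: "Re (cinner (T x) y) = Re (cinner x s)" for x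
      by (metis inner_eq_Re_cinner inner_commute)
    have "Im (cinner (T x) y) = Im (cinner x s)" for x
      using Re_eq[of "(- \<i>) *\<^sub>C x"] by (simp add: hom cinner_scaleC_left)
    with Re_eq show ?thesis by (auto simp: complex_eq_iff)
  qed
  then have "\<exists>S. \<forall>x y. cinner (T x) y = cinner x (S y)" by metis
  from someI_ex[OF this] show ?thesis unfolding cadjoint_def by blast
qed

section \<open>The semi-inner product of a positive operator\<close>

lemma bounded_clinear_add: "bounded_clinear T \<Longrightarrow> T (x + y) = T x + T y"
  and bounded_clinear_diff: "bounded_clinear T \<Longrightarrow> T (x - y) = T x - T y"
  and bounded_clinear_scaleC: "bounded_clinear T \<Longrightarrow> T (c *\<^sub>C x) = c *\<^sub>C T x"
  and bounded_clinear_scaleR: "bounded_clinear T \<Longrightarrow> T (r *\<^sub>R x) = r *\<^sub>R T x"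
  by (auto simp: bounded_clinear_def bounded_linear.linear linear_add linear_diff linear_cmul)

locale positive_operator =
  fixes A :: "'a::chilbert_space \<Rightarrow> 'a"
  assumes positive: "positive_op A"
begin

lemma bounded_clinear_A: "bounded_clinear A"
  using positive by (simp add: positive_op_def)

lemma A_inner_add_left: "A_inner A (x + y) z = A_inner A x z + A_inner A y z"
  and A_inner_add_right: "A_inner A x (y + z) = A_inner A x y + A_inner A x z"
  and A_inner_scaleC_left: "A_inner A (c *\<^sub>C x) y = c * A_inner A x y"
  and A_inner_scaleC_right: "A_inner A x (c *\<^sub>C y) = cnj c * A_inner A x y"
  using bounded_clinear_A
  by (simp_all add: A_inner_def bounded_clinear_add bounded_clinear_scaleC cinner_add_left
      cinner_add_right cinner_scaleC_left cinner_scaleC_right)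

lemma A_inner_diff_left: "A_inner A (x - y) z = A_inner A x z - A_inner A y z"
  using A_inner_add_left[of "x - y" y z] by simp

lemma A_inner_diff_right: "A_inner A x (y - z) = A_inner A x y - A_inner A x z"
  using A_inner_add_right[of x "y - z" z] by simp

lemma A_inner_self: "A_inner A x x = complex_of_real ((A_seminorm A x)\<^sup>2)"
  using positive
  by (auto simp: positive_op_def A_seminorm_def A_inner_def nonneg_Reals_def complex_eq_iff
      elim!: allE[of _ x])

text \<open>
  The form is real on the diagonal; at \<open>x + y\<close> and \<open>x + \<i> y\<close> this says that \<open>\<langle>x, y\<rangle> + \<langle>y, x\<rangle>\<close> and
  \<open>\<i> (\<langle>y, x\<rangle> - \<langle>x, y\<rangle>)\<close> are real.
\<close>

lemma A_inner_commute: "A_inner A x y = cnj (A_inner A y x)"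
proof -
  have "Im (A_inner A (x + y) (x + y)) = 0" "Im (A_inner A (x + \<i> *\<^sub>C y) (x + \<i> *\<^sub>C y)) = 0"
    "Im (A_inner A x x) = 0" "Im (A_inner A y y) = 0"
    by (simp_all only: A_inner_self Im_complex_of_real)
  then show ?thesis
    by (auto simp: A_inner_add_left A_inner_add_right A_inner_scaleC_left A_inner_scaleC_right
        complex_eq_iff)
qed

lemma self_adjoint: "cinner (A x) y = cinner x (A y)"
  using A_inner_commute[of x y] cinner_commute[of x "A y"] by (simp add: A_inner_def)

lemma A_seminorm_nonneg: "0 \<le> A_seminorm A x"
  using positive by (simp add: positive_op_def A_seminorm_def A_inner_def nonneg_Reals_def)
    (metis Re_complex_of_real)

lemma A_seminorm_scaleR: "A_seminorm A (r *\<^sub>R x) = \<bar>r\<bar> * A_seminorm A x"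
  by (simp add: A_seminorm_def scaleR_scaleC A_inner_scaleC_left A_inner_scaleC_right
      real_sqrt_mult mult.assoc[symmetric] del: of_real_mult)

lemma A_seminorm_parallelogram:
  "(A_seminorm A (x + y))\<^sup>2 + (A_seminorm A (x - y))\<^sup>2 = 2 * ((A_seminorm A x)\<^sup>2 + (A_seminorm A y)\<^sup>2)"
proof -
  have "complex_of_real ((A_seminorm A (x + y))\<^sup>2 + (A_seminorm A (x - y))\<^sup>2)
     = complex_of_real (2 * ((A_seminorm A x)\<^sup>2 + (A_seminorm A y)\<^sup>2))"
    unfolding of_real_add of_real_mult A_inner_self[symmetric]
    by (simp add: A_inner_add_left A_inner_add_right A_inner_diff_left A_inner_diff_right)
  then show ?thesis by (simp only: of_real_eq_iff)
qed

text \<open>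
  With \<open>c = \<langle>x, y\<rangle>\<close>, the square of the seminorm of \<open>t x - c y\<close> is a quadratic polynomial in the real
  variable \<open>t\<close>. When \<open>x\<close> has positive seminorm, nonnegativity at \<open>t = |c|\<^sup>2 / \<parallel>x\<parallel>\<^sup>2\<close> gives the claim;
  when it vanishes, the polynomial is linear in \<open>t\<close> and a large \<open>t\<close> forces \<open>c = 0\<close>.
\<close>

lemma A_cauchy_schwarz: "cmod (A_inner A x y) \<le> A_seminorm A x * A_seminorm A y"
proof -
  define c where "c = A_inner A x y"
  define a where "a = (A_seminorm A x)\<^sup>2"
  define b where "b = (A_seminorm A y)\<^sup>2"
  have nonneg: "0 \<le> a * t\<^sup>2 - 2 * t * (cmod c)\<^sup>2 + (cmod c)\<^sup>2 * b" for t :: real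
  proof -
    have "complex_of_real ((A_seminorm A (of_real t *\<^sub>C x - c *\<^sub>C y))\<^sup>2)
        = complex_of_real (a * t\<^sup>2 - 2 * t * (cmod c)\<^sup>2 + (cmod c)\<^sup>2 * b)"
      unfolding A_inner_self[symmetric] A_inner_diff_left A_inner_diff_right
        A_inner_scaleC_left A_inner_scaleC_right
      unfolding A_inner_commute[of y x] c_def[symmetric]
      unfolding A_inner_self a_def[symmetric] b_def[symmetric]
        of_real_add of_real_diff of_real_mult complex_norm_square
      by (simp add: ring_distribs power2_eq_square mult_ac)
    then show ?thesis by (metis of_real_eq_iff zero_le_power2)
  qed
  have "a \<ge> 0" "b \<ge> 0" by (simp_all add: a_def b_def)
  have "(cmod c)\<^sup>2 \<le> a * b"
  proof (cases "a = 0")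
    case True
    have "(b + 2) * (cmod c)\<^sup>2 \<le> 0"
      using nonneg[of "b + 1"] True by (simp add: algebra_simps)
    with \<open>b \<ge> 0\<close> have "(cmod c)\<^sup>2 \<le> 0" by (simp add: mult_le_0_iff)
    then show ?thesis using \<open>a \<ge> 0\<close> \<open>b \<ge> 0\<close> by (simp add: True)
  next
    case False
    with \<open>a \<ge> 0\<close> have "a > 0" by simp
    show ?thesis
    proof (cases "c = 0")
      case True
      then show ?thesis using \<open>a \<ge> 0\<close> \<open>b \<ge> 0\<close> by simp
    next
      case False
      have "a * ((cmod c)\<^sup>2 / a)\<^sup>2 = (cmod c)\<^sup>2 * ((cmod c)\<^sup>2 / a)"
        using \<open>a > 0\<close> by (simp add: power2_eq_square)
      with nonneg[of "(cmod c)\<^sup>2 / a"]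
      have "0 \<le> (cmod c)\<^sup>2 * (b - (cmod c)\<^sup>2 / a)"
        by (simp add: algebra_simps)
      then have "(cmod c)\<^sup>2 / a \<le> b"
        using False by (simp add: zero_le_mult_iff)
      then show ?thesis using \<open>a > 0\<close> by (simp add: field_simps)
    qed
  qed
  then have "(cmod c)\<^sup>2 \<le> (A_seminorm A x * A_seminorm A y)\<^sup>2"
    by (simp add: a_def b_def power_mult_distrib)
  then show ?thesis
    unfolding c_def by (rule power2_le_imp_le) (simp add: A_seminorm_nonneg)
qed

lemma A_seminorm_eq_0_iff: "A_seminorm A x = 0 \<longleftrightarrow> A x = 0"
proof
  assume "A_seminorm A x = 0"
  with A_cauchy_schwarz[of x "A x"] have "A_inner A x (A x) = 0" by simp
  then have "inner (A x) (A x) = 0" by (simp add: A_inner_def inner_eq_Re_cinner)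
  then show "A x = 0" by simp
qed (simp add: A_seminorm_def A_inner_def)

section \<open>Numerical radius and operator seminorm\<close>

text \<open>
  Homogeneity extends the defining bound from unit vectors to all vectors. On vectors of seminorm
  \<open>0\<close>, which cannot be normalized, the left-hand side vanishes because \<open>A\<close> is self-adjoint.
\<close>

lemma A_inner_le_numradius:
  assumes T: "bounded_clinear T" and w: "A_numradius A T \<le> ennreal w" and "0 \<le> w"
  shows "cmod (A_inner A (T x) x) \<le> w * (A_seminorm A x)\<^sup>2"
proof (cases "A_seminorm A x = 0")
  case True
  then have "A x = 0" by (simp add: A_seminorm_eq_0_iff)
  then have "A_inner A (T x) x = 0" by (simp add: A_inner_def self_adjoint)
  then show ?thesis using \<open>0 \<le> w\<close> by simp
next
  case False
  define s where "s = A_seminorm A x"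
  have "s > 0" using False A_seminorm_nonneg[of x] by (simp add: s_def)
  define u where "u = (1 / s) *\<^sub>R x"
  have xu: "x = s *\<^sub>R u" using \<open>s > 0\<close> by (simp add: u_def)
  have "A_seminorm A u = 1" using \<open>s > 0\<close> by (simp add: u_def A_seminorm_scaleR s_def)
  then have "ennreal (cmod (A_inner A (T u) u)) \<le> A_numradius A T"
    unfolding A_numradius_def by (intro SUP_upper) simp
  with w have "ennreal (cmod (A_inner A (T u) u)) \<le> ennreal w" by (rule order_trans[rotated])
  then have "cmod (A_inner A (T u) u) \<le> w" using \<open>0 \<le> w\<close> by simp
  moreover have "cmod (A_inner A (T x) x) = s\<^sup>2 * cmod (A_inner A (T u) u)"
    using \<open>s > 0\<close> unfolding xu bounded_clinear_scaleR[OF T]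
    by (simp add: scaleR_scaleC A_inner_scaleC_left A_inner_scaleC_right norm_mult
        power2_eq_square)
  ultimately show ?thesis by (simp add: s_def[symmetric] mult.commute[of w] mult_left_mono)
qed

text \<open>
  Polarization: the pair is half the difference of the quadratic forms at \<open>x + y\<close> and \<open>x - y\<close>, and
  the parallelogram law adds up the two bounds.
\<close>

lemma symmetrized_form_le:
  assumes T: "bounded_clinear T" and w: "A_numradius A T \<le> ennreal w" and "0 \<le> w"
  shows "cmod (A_inner A (T x) y + A_inner A (T y) x) \<le> w * ((A_seminorm A x)\<^sup>2 + (A_seminorm A y)\<^sup>2)"
proof -
  have "2 * (A_inner A (T x) y + A_inner A (T y) x)
      = A_inner A (T (x + y)) (x + y) - A_inner A (T (x - y)) (x - y)"
    using T by (simp add: bounded_clinear_add bounded_clinear_diff A_inner_add_left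
        A_inner_add_right A_inner_diff_left A_inner_diff_right)
  from arg_cong[OF this, of cmod]
  have "2 * cmod (A_inner A (T x) y + A_inner A (T y) x)
      = cmod (A_inner A (T (x + y)) (x + y) - A_inner A (T (x - y)) (x - y))"
    by (simp only: norm_mult norm_numeral)
  also have "\<dots> \<le> w * (A_seminorm A (x + y))\<^sup>2 + w * (A_seminorm A (x - y))\<^sup>2"
    using A_inner_le_numradius[OF assms, of "x + y"] A_inner_le_numradius[OF assms, of "x - y"]
    by (intro order_trans[OF norm_triangle_ineq4] add_mono)
  also have "\<dots> = 2 * (w * ((A_seminorm A x)\<^sup>2 + (A_seminorm A y)\<^sup>2))"
    by (simp only: distrib_left[symmetric] A_seminorm_parallelogram)
  finally show ?thesis by simp
qed

text \<open>
  If \<open>A X = T\<^sup>* A\<close>, then \<open>\<langle>A T z, y\<rangle> = \<langle>z, T\<^sup>* A y\<rangle> = \<langle>z, A X y\<rangle> = \<langle>A z, X y\<rangle>\<close> for all \<open>y\<close>.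
\<close>

lemma A_adjointable_kernel:
  assumes "T \<in> A_adjointable A" "A z = 0"
  shows "A (T z) = 0"
proof -
  from assms obtain X where T: "bounded_clinear T" and X: "A \<circ> X = cadjoint T \<circ> A"
    by (auto simp: A_adjointable_def)
  have "cinner (A (T z)) y = 0" for y
  proof -
    have "cinner (A (T z)) y = cinner z (cadjoint T (A y))"
      by (simp add: self_adjoint cinner_cadjoint[OF T])
    also have "\<dots> = cinner (A z) (X y)"
      using fun_cong[OF X, of y] by (simp add: self_adjoint)
    finally show ?thesis by (simp add: assms)
  qed
  from this[of "A (T z)"] have "inner (A (T z)) (A (T z)) = 0"
    by (simp add: inner_eq_Re_cinner)
  then show ?thesis by simp
qed

text \<open>
  Here \<open>p\<close> is the orthogonal projection of \<open>x\<close>; as \<open>A\<close> is self-adjoint, a vector orthogonal to its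
  range lies in its kernel.
\<close>

lemma range_closure_decomposition:
  obtains p where "p \<in> closure (range A)" "A (x - p) = 0"
proof -
  have lin: "linear A"
    using bounded_clinear_A by (simp add: bounded_clinear_def bounded_linear.linear)
  have "subspace (closure (range A))"
    using lin by (intro subspace_closure_set linear_subspace_image subspace_UNIV)
  from riesz_closed_subspace[OF this closed_closure bounded_linear_inner_right[of x]]
  obtain p where p: "p \<in> closure (range A)"
    and orth: "\<And>y. y \<in> closure (range A) \<Longrightarrow> inner p y = inner x y" by blast
  have "A (A (x - p)) \<in> closure (range A)" by (simp add: closure_subset[THEN subsetD])
  from orth[OF this] have "inner (x - p) (A (A (x - p))) = 0" by (simp add: inner_diff_left)
  then have "inner (A (x - p)) (A (x - p)) = 0"
    by (simp add: inner_eq_Re_cinner self_adjoint)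
  then have "A (x - p) = 0" by simp
  with p show thesis by (rule that)
qed

lemma A_seminorm_cong: "A (x - y) = 0 \<Longrightarrow> A_seminorm A x = A_seminorm A y"
  using A_inner_diff_left[of x y x] A_inner_diff_right[of y x y] self_adjoint[of y "x - y"]
  by (simp add: A_seminorm_def A_inner_def)

text \<open>
  Invariance of the kernel allows \<open>x\<close> to be replaced by its projection \<open>p\<close> to the closure of the
  range of \<open>A\<close>: neither the seminorm of \<open>x\<close> nor that of \<open>T x\<close> changes, and \<open>p\<close> is among the vectors
  over which the operator seminorm is a supremum.
\<close>

lemma A_inner_le_opnorm:
  assumes T: "bounded_clinear T" and ker: "\<And>z. A z = 0 \<Longrightarrow> A (T z) = 0"
    and x: "A_seminorm A x = 1"
  shows "ennreal (cmod (A_inner A (T x) x)) \<le> A_opnorm A T"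
proof -
  obtain p where p: "p \<in> closure (range A)" "A (x - p) = 0"
    by (rule range_closure_decomposition)
  have "A_seminorm A p = 1" using A_seminorm_cong[OF p(2)] x by simp
  moreover have "A_seminorm A (0::'a) = 0"
    using A_seminorm_scaleR[of 0 "0::'a"] by simp
  ultimately have "p \<noteq> 0" by auto
  have "A (T x - T p) = 0" using ker[OF p(2)] T by (simp add: bounded_clinear_diff)
  then have "A_seminorm A (T x) = A_seminorm A (T p)" by (rule A_seminorm_cong)
  with A_cauchy_schwarz[of "T x" x] x \<open>A_seminorm A p = 1\<close>
  have "ennreal (cmod (A_inner A (T x) x)) \<le> ennreal (A_seminorm A (T p) / A_seminorm A p)"
    by (simp add: ennreal_leI)
  also have "\<dots> \<le> A_opnorm A T"
    unfolding A_opnorm_def using p \<open>p \<noteq> 0\<close> by (intro SUP_upper) simp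
  finally show ?thesis .
qed

lemma A_numradius_le_opnorm_diff_add:
  assumes S: "S \<in> A_adjointable A" and T: "T \<in> A_adjointable A"
  shows "A_numradius A T \<le> ennreal (1 / 2) * (A_opnorm A (S - T) + A_opnorm A (S + T))"
proof -
  have bS: "bounded_clinear S" and bT: "bounded_clinear T"
    using S T by (auto simp: A_adjointable_def)
  have "c *\<^sub>C (x - y) = c *\<^sub>C x - c *\<^sub>C y" for c and x y :: 'a
    using scaleC_add_right[of c "x - y" y] by (simp add: algebra_simps)
  with bS bT have bd: "bounded_clinear (S - T)"
    by (simp add: bounded_clinear_def fun_diff_def bounded_linear_sub)
  from bS bT have ba: "bounded_clinear (S + T)"
    by (simp add: bounded_clinear_def plus_fun_def bounded_linear_add scaleC_add_right)
  have kd: "A ((S - T) z) = 0" and ka: "A ((S + T) z) = 0" if "A z = 0" for z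
    using A_adjointable_kernel[OF S that] A_adjointable_kernel[OF T that] bounded_clinear_A
    by (simp_all add: bounded_clinear_add bounded_clinear_diff)
  show ?thesis
    unfolding A_numradius_def
  proof (intro SUP_least)
    fix x assume "x \<in> {x. A_seminorm A x = 1}"
    then have x: "A_seminorm A x = 1" by simp
    have "cmod (2 * A_inner A (T x) x) = cmod (A_inner A ((S + T) x) x - A_inner A ((S - T) x) x)"
      by (rule arg_cong[of _ _ cmod]) (simp add: A_inner_add_left A_inner_diff_left)
    also have "\<dots> \<le> cmod (A_inner A ((S + T) x) x) + cmod (A_inner A ((S - T) x) x)"
      by (rule norm_triangle_ineq4)
    finally have "2 * cmod (A_inner A (T x) x)
        \<le> cmod (A_inner A ((S - T) x) x) + cmod (A_inner A ((S + T) x) x)"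
      by (simp add: norm_mult)
    then have "ennreal (cmod (A_inner A (T x) x)) \<le> ennreal (1 / 2 *
        (cmod (A_inner A ((S - T) x) x) + cmod (A_inner A ((S + T) x) x)))"
      by (intro ennreal_leI) simp
    also have "\<dots> = ennreal (1 / 2) *
        (ennreal (cmod (A_inner A ((S - T) x) x)) + ennreal (cmod (A_inner A ((S + T) x) x)))"
      by (simp only: ennreal_mult ennreal_plus norm_ge_zero add_nonneg_nonneg)
    also have "\<dots> \<le> ennreal (1 / 2) * (A_opnorm A (S - T) + A_opnorm A (S + T))"
      by (intro mult_left_mono add_mono zero_le A_inner_le_opnorm[OF bd kd x]
          A_inner_le_opnorm[OF ba ka x])
    finally show "ennreal (cmod (A_inner A (T x) x))
        \<le> ennreal (1 / 2) * (A_opnorm A (S - T) + A_opnorm A (S + T))" .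
  qed
qed

section \<open>The Hankel operator matrix\<close>

lemma vector_4:
  "(vector [w, x, y, z] :: 'b::zero ^ 4) $ 1 = w"
  "(vector [w, x, y, z] :: 'b::zero ^ 4) $ 2 = x"
  "(vector [w, x, y, z] :: 'b::zero ^ 4) $ 3 = y"
  "(vector [w, x, y, z] :: 'b::zero ^ 4) $ 4 = z"
  unfolding vector_def by simp_all

lemma A_inner_block_diagonal:
  "A_inner (block_op (mat A)) x y = (\<Sum>i\<in>UNIV. A_inner A (x $ i) (y $ i))"
proof -
  have "(\<Sum>j\<in>UNIV. (mat A $ i $ j) (x $ j)) = A (x $ i)" for i
  proof -
    have "(mat A $ i $ j) (x $ j) = (if j = i then A (x $ i) else 0)" for j
      by (simp add: mat_def)
    then show ?thesis by simp
  qed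
  then show ?thesis by (simp add: A_inner_def cinner_vec_def block_op_def)
qed

text \<open>
  The quadratic form at \<open>(a, b, c, d)\<close> is the sum of four parts \<open>s\<^sub>1, \<dots>, s\<^sub>4\<close>, one for each operator.
  In each part every coordinate occurs in exactly one diagonal term or symmetrized pair, and the
  factor \<open>\<i>\<close> does not change absolute values.
\<close>

lemma A_numradius_hankel_le:
  assumes T: "bounded_clinear T1" "bounded_clinear T2" "bounded_clinear T3" "bounded_clinear T4"
  shows "A_numradius (block_op (mat A :: ('a \<Rightarrow> 'a) ^ 4 ^ 4))
      (block_op (vector
        [vector [T1, T2, T3, T4],
         vector [T2, T3, T4, \<i> *\<^sub>C T1],
         vector [T3, T4, \<i> *\<^sub>C T1, \<i> *\<^sub>C T2],
         vector [T4, \<i> *\<^sub>C T1, \<i> *\<^sub>C T2, \<i> *\<^sub>C T3]]))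
    \<le> A_numradius A T4 + (A_numradius A T1 + A_numradius A T3) + A_numradius A T2"
    (is "A_numradius ?AA (block_op ?M) \<le> ?w")
proof (cases "?w = top")
  case False
  \<comment> \<open>Finite radii can be treated as real numbers, to which the bounds on the forms apply.\<close>
  then have "A_numradius A T1 \<noteq> top" "A_numradius A T2 \<noteq> top" "A_numradius A T3 \<noteq> top"
    "A_numradius A T4 \<noteq> top" by auto
  then obtain w1 w2 w3 w4 where w: "A_numradius A T1 = ennreal w1" "A_numradius A T2 = ennreal w2"
    "A_numradius A T3 = ennreal w3" "A_numradius A T4 = ennreal w4"
    and nn: "0 \<le> w1" "0 \<le> w2" "0 \<le> w3" "0 \<le> w4"
    by (metis ennreal_cases)
  note bounds = A_inner_le_numradius[OF T(1) eq_refl[OF w(1)] nn(1)]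
    A_inner_le_numradius[OF T(3) eq_refl[OF w(3)] nn(3)]
  note sym = symmetrized_form_le[OF T(1) eq_refl[OF w(1)] nn(1)]
    symmetrized_form_le[OF T(2) eq_refl[OF w(2)] nn(2)]
    symmetrized_form_le[OF T(3) eq_refl[OF w(3)] nn(3)]
    symmetrized_form_le[OF T(4) eq_refl[OF w(4)] nn(4)]
  have "cmod (A_inner ?AA (block_op ?M x) x) \<le> w4 + (w1 + w3) + w2"
    if "A_seminorm ?AA x = 1" for x :: "'a ^ 4"
  proof -
    define a b c d where "a = x $ 1" and "b = x $ 2" and "c = x $ 3" and "d = x $ 4"
    note abcd = a_def[symmetric] b_def[symmetric] c_def[symmetric] d_def[symmetric]
    let ?n = "\<lambda>u. (A_seminorm A u)\<^sup>2" and ?q = "\<lambda>T u v. A_inner A (T u) v"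
    have unit: "?n a + ?n b + ?n c + ?n d = 1"
    proof -
      have "Re (A_inner ?AA x x) = 1"
        using that by (simp add: A_seminorm_def)
      then show ?thesis by (simp add: A_inner_block_diagonal sum_4 abcd A_inner_self)
    qed
    define s4 s1 s3 s2 where
      "s4 = (?q T4 a d + ?q T4 d a) + (?q T4 b c + ?q T4 c b)" and
      "s1 = ?q T1 a a + \<i> * ?q T1 c c + \<i> * (?q T1 b d + ?q T1 d b)" and
      "s3 = ?q T3 b b + \<i> * ?q T3 d d + (?q T3 a c + ?q T3 c a)" and
      "s2 = (?q T2 a b + ?q T2 b a) + \<i> * (?q T2 c d + ?q T2 d c)"
    have form: "A_inner ?AA (block_op ?M x) x = s4 + (s1 + s3) + s2"
      by (simp add: A_inner_block_diagonal block_op_def sum_4 vector_4 abcd scaleC_fun_def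
          A_inner_add_left A_inner_scaleC_left s1_def s2_def s3_def s4_def algebra_simps)
    have rotate: "cmod (\<i> * z) \<le> r" if "cmod z \<le> r" for z r
      using that by (simp add: norm_mult)
    note add = norm_triangle_mono
    have "cmod s4 \<le> w4 * (?n a + ?n d) + w4 * (?n b + ?n c)"
      unfolding s4_def by (rule add[OF sym(4) sym(4)])
    moreover have "cmod s1 \<le> w1 * ?n a + w1 * ?n c + w1 * (?n b + ?n d)"
      unfolding s1_def by (rule add[OF add[OF bounds(1) rotate[OF bounds(1)]] rotate[OF sym(1)]])
    moreover have "cmod s3 \<le> w3 * ?n b + w3 * ?n d + w3 * (?n a + ?n c)"
      unfolding s3_def by (rule add[OF add[OF bounds(2) rotate[OF bounds(2)]] sym(3)])
    moreover have "cmod s2 \<le> w2 * (?n a + ?n b) + w2 * (?n c + ?n d)"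
      unfolding s2_def by (rule add[OF sym(2) rotate[OF sym(2)]])
    ultimately have "cmod (s4 + (s1 + s3) + s2)
        \<le> (w4 + (w1 + w3) + w2) * (?n a + ?n b + ?n c + ?n d)"
      by (intro order_trans[OF add[OF add[OF _ add]]]) (assumption | simp add: algebra_simps)+
    then show ?thesis by (simp add: form unit)
  qed
  then have "A_numradius ?AA (block_op ?M) \<le> ennreal (w4 + (w1 + w3) + w2)"
    unfolding A_numradius_def[of ?AA] by (intro SUP_least ennreal_leI) simp
  then show ?thesis using nn by (simp add: w)
next
  case True
  show ?thesis unfolding True by (rule top_greatest)
qed

end

theorem proposition4p5:
  fixes A T1 T2 T3 T4 :: "'a::chilbert_space \<Rightarrow> 'a"
  assumes "positive_op A"
    and "T1 \<in> A_adjointable A"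
    and "T2 \<in> A_adjointable A"
    and "T3 \<in> A_adjointable A"
    and "T4 \<in> A_adjointable A"
  shows "A_numradius (block_op (mat A :: ('a \<Rightarrow> 'a) ^ 4 ^ 4))
      (block_op (vector
        [vector [T1, T2, T3, T4],
         vector [T2, T3, T4, \<i> *\<^sub>C T1],
         vector [T3, T4, \<i> *\<^sub>C T1, \<i> *\<^sub>C T2],
         vector [T4, \<i> *\<^sub>C T1, \<i> *\<^sub>C T2, \<i> *\<^sub>C T3]]))
    \<le> A_numradius A T4 + 2 * max (A_numradius A T1) (A_numradius A T3)
      + ennreal (1 / sqrt 2) * (A_opnorm A (T1 - T2) + A_opnorm A (T1 + T2))
      + ennreal (1 / sqrt 2) * (A_opnorm A (T2 - T3) + A_opnorm A (T2 + T3))"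
proof -
  interpret positive_operator A by unfold_locales fact
  let ?N = "A_opnorm A (T1 - T2) + A_opnorm A (T1 + T2)"
  have bounded: "bounded_clinear T1" "bounded_clinear T2" "bounded_clinear T3" "bounded_clinear T4"
    using assms by (auto simp: A_adjointable_def)
  have diagonal: "A_numradius A T1 + A_numradius A T3
      \<le> 2 * max (A_numradius A T1) (A_numradius A T3)"
    unfolding mult_2 by (intro add_mono) auto
  have "sqrt 2 \<le> sqrt (2\<^sup>2)" by (intro real_sqrt_le_mono) simp
  then have "1 / 2 \<le> 1 / sqrt 2" by (simp add: field_simps)
  then have T2: "A_numradius A T2 \<le> ennreal (1 / sqrt 2) * ?N"
    using A_numradius_le_opnorm_diff_add[OF assms(2,3)]
    by (meson order_trans mult_right_mono ennreal_leI zero_le)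
  show ?thesis
    by (rule order_trans[OF A_numradius_hankel_le[OF bounded]],
        rule order_trans[OF add_mono[OF add_mono[OF order_refl diagonal] T2]],
        rule add_increasing2[OF zero_le order_refl])
qed

end
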